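(* Let $a$ and $b$ be linear operators on the Hilbert space $\mathbb{C}^2$ satisfying $ab+ba=I$ and $a^2=b^2=0$, where $I$ is the identity operator. Define $$\mu_1=b+a,\qquad \mu_2=i(b-a),\qquad \mu_3=ab-ba.$$ Then $\mu_j^2=I$ for $j=1,2,3$, and $$\mu_1\mu_2=i\mu_3,\qquad \mu_2\mu_3=i\mu_1,\qquad \mu_3\mu_1=i\mu_2,\qquad (\mu_1\mu_2)^4=(\mu_2\mu_3)^4=(\mu_3\mu_1)^4=I,$$ and $\mu_1,\mu_2,\mu_3$ are a concrete realization of the Pauli group $P$, i.e. the group generated by $\mu_1,\mu_2,\mu_3$ is isomorphic to $P$. The same holds for the adjoints $\rho_j=\mu_j^\dagger$, $j=1,2,3$: one has $\rho_j^2=I$ for $j=1,2,3$, $\rho_1\rho_2=i\rho_3$, $\rho_2\rho_3=i\rho_1$, $\rho_3\rho_1=i\rho_2$, and the group generated by $\rho_1,\rho_2,\rho_3$ is isomorphic to $P$.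
   Context: The Pauli group $P$ is the group of order $16$ generated by the matrices $X=\begin{pmatrix}0&1\\1&0\end{pmatrix}$, $Y=\begin{pmatrix}0&-i\\i&0\end{pmatrix}$, $Z=\begin{pmatrix}1&0\\0&-1\end{pmatrix}$ under matrix multiplication. Operators $a,b$ satisfying $ab+ba=I$, $a^2=b^2=0$ are called pseudo-fermionic operators; it is not assumed that $b=a^\dagger$. The symbol $^\dagger$ denotes the adjoint with respect to the standard inner product of $\mathbb{C}^2$. *)

theory Defs
  imports "HOL-Analysis.Analysis" "HOL-Algebra.Elementary_Groups"
begin

abbreviation clinear :: "(complex^2 \<Rightarrow> complex^2) \<Rightarrow> bool" where
  "clinear \<equiv> Vector_Spaces.linear (*s) (*s)"

text \<open>The library's \<open>inner\<close> and \<open>adjoint\<close> on \<open>complex^2\<close> are the ones of the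
  underlying real inner product space, hence the Hermitian versions here.\<close>

definition cinner :: "complex^2 \<Rightarrow> complex^2 \<Rightarrow> complex" where
  "cinner x y = (\<Sum>i\<in>UNIV. cnj (x $ i) * y $ i)"

definition cadjoint :: "(complex^2 \<Rightarrow> complex^2) \<Rightarrow> complex^2 \<Rightarrow> complex^2" where
  "cadjoint f = (SOME g. \<forall>x y. cinner (f x) y = cinner x (g y))"

lemma cadjoint_works:
  assumes "clinear f"
  shows "cinner (f x) y = cinner x (cadjoint f y)"
proof -
  have f: "f = (*v) (matrix f)"
    using matrix_works[OF assms] by (simp add: fun_eq_iff)
  define A where "A = matrix f"
  define g :: "complex^2 \<Rightarrow> complex^2"
    where "g = (\<lambda>y. \<chi> j. \<Sum>i\<in>UNIV. cnj (A $ i $ j) * y $ i)"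
  have "\<forall>x y. cinner (A *v x) y = cinner x (g y)"
    by (simp add: cinner_def g_def matrix_vector_mult_def sum_2 algebra_simps)
  then have "\<exists>g. \<forall>x y. cinner (f x) y = cinner x (g y)"
    using f A_def by metis
  then have "\<forall>x y. cinner (f x) y = cinner x (cadjoint f y)"
    unfolding cadjoint_def by (rule someI_ex)
  then show ?thesis by blast
qed

lemma cadjoint_unique:
  assumes "\<And>x y. cinner (f x) y = cinner x (g y)"
  shows "cadjoint f = g"
proof -
  have "\<forall>x y. cinner (f x) y = cinner x (cadjoint f y)"
    unfolding cadjoint_def by (rule someI[of _ g]) (simp add: assms)
  then have eq: "cinner x (cadjoint f y) = cinner x (g y)" for x y
    using assms by metis
  have "cadjoint f y $ i = g y $ i" for y i
    using eq[of "axis i 1" y] exhaust_2[of i] by (auto simp: cinner_def sum_2 axis_def)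
  then show ?thesis by (simp add: fun_eq_iff vec_eq_iff)
qed

definition operator_monoid :: "(complex^2 \<Rightarrow> complex^2) monoid" where
  "operator_monoid = \<lparr>carrier = {f. clinear f}, mult = (\<circ>), one = id\<rparr>"

definition matrix_monoid :: "(complex^2^2) monoid" where
  "matrix_monoid = \<lparr>carrier = UNIV, mult = (**), one = mat 1\<rparr>"

definition pauli_X :: "complex^2^2" where
  "pauli_X = vector [vector [0, 1], vector [1, 0]]"

definition pauli_Y :: "complex^2^2" where
  "pauli_Y = vector [vector [0, - \<i>], vector [\<i>, 0]]"

definition pauli_Z :: "complex^2^2" where
  "pauli_Z = vector [vector [1, 0], vector [0, -1]]"

text \<open>\<open>subgroup_generated G S\<close> intersects \<open>S\<close> with the carrier of \<open>G\<close>; the generators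
  used here and in the theorem are all involutions, hence units.\<close>

definition pauli_group :: "(complex^2^2) monoid" where
  "pauli_group = subgroup_generated (units_of matrix_monoid) {pauli_X, pauli_Y, pauli_Z}"

definition operator_group :: "(complex^2 \<Rightarrow> complex^2) set \<Rightarrow> (complex^2 \<Rightarrow> complex^2) monoid" where
  "operator_group S = subgroup_generated (units_of operator_monoid) S"

end

theory Submission imports Defs begin

text \<open>The Pauli relations make \<open>I, X, Y, Z \<mapsto> id, \<mu>\<^sub>1, \<mu>\<^sub>2, \<mu>\<^sub>3\<close> extend linearly to a multiplicative
  map on all complex 2 by 2 matrices. It is injective, because averaging
  \<open>c\<^sub>0 + c\<^sub>1\<mu>\<^sub>1 + c\<^sub>2\<mu>\<^sub>2 + c\<^sub>3\<mu>\<^sub>3\<close> over conjugation by the \<open>\<mu>\<^sub>j\<close> leaves only \<open>c\<^sub>0\<close>, and hence it restricts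
  to an isomorphism between the generated groups. Taking adjoints reverses products and conjugates \<open>\<i>\<close>,
  so the adjoints satisfy the same relations.\<close>

section \<open>Groups of units and generated subgroups\<close>

lemma clinear_iff:
  "clinear f \<longleftrightarrow> (\<forall>x y. f (x + y) = f x + f y) \<and> (\<forall>c x. f (c *s x) = c *s f x)"
  by (simp add: Vector_Spaces.linear_iff vec.vector_space_axioms)

lemma group_units_of_operator_monoid: "group (units_of operator_monoid)"
proof -
  have "monoid operator_monoid"
    by (rule monoidI) (auto simp: operator_monoid_def clinear_iff fun_eq_iff)
  then show ?thesis by (rule monoid.units_group)
qed

lemma group_units_of_matrix_monoid: "group (units_of matrix_monoid)"
proof -
  have "monoid matrix_monoid"
    by (rule monoidI) (auto simp: matrix_monoid_def matrix_mul_assoc)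
  then show ?thesis by (rule monoid.units_group)
qed

text \<open>Images of mutual inverses are mutual inverses once \<open>h\<close> preserves the
  identity, which multiplicativity alone does not give between monoids.\<close>

lemma hom_units_of:
  assumes "h \<in> hom G H" "h \<one>\<^bsub>G\<^esub> = \<one>\<^bsub>H\<^esub>"
  shows "h \<in> hom (units_of G) (units_of H)"
proof (rule homI)
  fix x assume "x \<in> carrier (units_of G)"
  then obtain y where "x \<in> carrier G" "y \<in> carrier G" "y \<otimes>\<^bsub>G\<^esub> x = \<one>\<^bsub>G\<^esub>" "x \<otimes>\<^bsub>G\<^esub> y = \<one>\<^bsub>G\<^esub>"
    by (auto simp: units_of_def Units_def)
  then have "h y \<otimes>\<^bsub>H\<^esub> h x = \<one>\<^bsub>H\<^esub>" "h x \<otimes>\<^bsub>H\<^esub> h y = \<one>\<^bsub>H\<^esub>" "h x \<in> carrier H" "h y \<in> carrier H"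
    using assms by (metis hom_mult hom_in_carrier)+
  then show "h x \<in> carrier (units_of H)"
    by (auto simp: units_of_def Units_def)
next
  fix x y assume "x \<in> carrier (units_of G)" "y \<in> carrier (units_of G)"
  then show "h (x \<otimes>\<^bsub>units_of G\<^esub> y) = h x \<otimes>\<^bsub>units_of H\<^esub> h y"
    using assms by (auto simp: units_of_def Units_def hom_mult)
qed

lemma (in group_hom) iso_subgroup_generated_image:
  assumes "inj_on h (carrier G)" "S \<subseteq> carrier G"
  shows "h \<in> iso (subgroup_generated G S) (subgroup_generated H (h ` S))"
proof -
  have hS: "h ` S \<subseteq> carrier H"
    using assms(2) by auto
  have "bij_betw h (generate G S) (generate H (h ` S))"
    unfolding bij_betw_def
    using generate_img[OF assms(2)] G.generate_incl[OF assms(2)] assms(1) by (auto intro: inj_on_subset)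
  then show ?thesis
    using hom_between_subgroups[of S "h ` S"] assms(2) hS
    by (simp add: iso_def carrier_subgroup_generated Int_absorb1)
qed

section \<open>Operators satisfying the Pauli relations\<close>

locale pauli_triple =
  fixes m1 m2 m3 :: "complex^2 \<Rightarrow> complex^2"
  assumes linear: "clinear m1" "clinear m2" "clinear m3"
    and square: "m1 \<circ> m1 = id" "m2 \<circ> m2 = id" "m3 \<circ> m3 = id"
    and cyclic: "m1 \<circ> m2 = (\<lambda>x. \<i> *s m3 x)" "m2 \<circ> m3 = (\<lambda>x. \<i> *s m1 x)"
      "m3 \<circ> m1 = (\<lambda>x. \<i> *s m2 x)"
begin

lemma add: "m1 (x + y) = m1 x + m1 y" "m2 (x + y) = m2 x + m2 y" "m3 (x + y) = m3 x + m3 y"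
  using linear by (auto simp: clinear_iff)

lemma scale: "m1 (c *s x) = c *s m1 x" "m2 (c *s x) = c *s m2 x" "m3 (c *s x) = c *s m3 x"
  using linear by (auto simp: clinear_iff)

lemma square_apply: "m1 (m1 x) = x" "m2 (m2 x) = x" "m3 (m3 x) = x"
  using square by (auto simp: fun_eq_iff)

lemma cyclic_apply: "m1 (m2 x) = \<i> *s m3 x" "m2 (m3 x) = \<i> *s m1 x" "m3 (m1 x) = \<i> *s m2 x"
  using cyclic by (auto simp: fun_eq_iff)

lemma reversed_apply:
  "m2 (m1 x) = (-\<i>) *s m3 x" "m3 (m2 x) = (-\<i>) *s m1 x" "m1 (m3 x) = (-\<i>) *s m2 x"
proof -
  \<comment> \<open>Evaluating \<open>m3 (m1 x) = \<i> *s m2 x\<close> at \<open>m1 x\<close>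
    cancels \<open>m1\<close> against itself on the left; the other two are analogous.\<close>
  have "\<i> *s m2 (m1 x) = m3 x" "\<i> *s m3 (m2 x) = m1 x" "\<i> *s m1 (m3 x) = m2 x"
    by (metis cyclic_apply scale square_apply)+
  then have "(-\<i>) *s (\<i> *s m2 (m1 x)) = (-\<i>) *s m3 x" "(-\<i>) *s (\<i> *s m3 (m2 x)) = (-\<i>) *s m1 x"
    "(-\<i>) *s (\<i> *s m1 (m3 x)) = (-\<i>) *s m2 x"
    by simp_all
  then show "m2 (m1 x) = (-\<i>) *s m3 x" "m3 (m2 x) = (-\<i>) *s m1 x" "m1 (m3 x) = (-\<i>) *s m2 x"
    by (simp_all add: vector_smult_assoc)
qed

lemmas mult_table = square_apply cyclic_apply reversed_apply

text \<open>Each product is \<i> times an involution, so its square is minus the identity.\<close>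

lemma funpow_4: "(m1 \<circ> m2) ^^ 4 = id" "(m2 \<circ> m3) ^^ 4 = id" "(m3 \<circ> m1) ^^ 4 = id"
  by (simp_all add: cyclic numeral_eq_Suc fun_eq_iff scale square_apply vector_smult_assoc)

section \<open>Linear combinations and the matrix representation\<close>

definition comb :: "complex \<Rightarrow> complex \<Rightarrow> complex \<Rightarrow> complex \<Rightarrow> complex^2 \<Rightarrow> complex^2" where
  "comb c0 c1 c2 c3 x = c0 *s x + c1 *s m1 x + c2 *s m2 x + c3 *s m3 x"

lemma comb_eq_0_imp_scalar_part:
  assumes "\<And>x. comb c0 c1 c2 c3 x = 0"
  shows "c0 = 0"
proof -
  define x :: "complex^2" where "x = axis 1 1"
  have zero: "m1 0 = 0" "m2 0 = 0" "m3 0 = 0"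
    using scale[of 0 0] by simp_all
  \<comment> \<open>Conjugation by \<open>m1\<close> fixes \<open>id\<close> and \<open>m1\<close>
    and negates \<open>m2\<close> and \<open>m3\<close>, and likewise cyclically. So each of
    \<open>c1\<close>, \<open>c2\<close>, \<open>c3\<close> occurs twice with each sign and cancels,
    while \<open>c0\<close> occurs four times.\<close>
  have "comb c0 c1 c2 c3 x + m1 (comb c0 c1 c2 c3 (m1 x)) + m2 (comb c0 c1 c2 c3 (m2 x))
      + m3 (comb c0 c1 c2 c3 (m3 x)) = (4 * c0) *s x"
    by (simp only: comb_def add scale mult_table) (simp add: vec_eq_iff algebra_simps)
  then have "(4 * c0) *s x = 0"
    by (simp add: assms zero)
  then show ?thesis
    by (simp add: x_def)
qed

lemma comb_eq_0_imp:
  assumes "\<And>x. comb c0 c1 c2 c3 x = 0"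
  shows "c0 = 0" "c1 = 0" "c2 = 0" "c3 = 0"
proof -
  \<comment> \<open>Composing with a generator on the right moves its coefficient into the scalar
    slot, where \<open>comb_eq_0_imp_scalar_part\<close> applies.\<close>
  have "comb c1 c0 (\<i> * c3) (- (\<i> * c2)) x = comb c0 c1 c2 c3 (m1 x)"
    "comb c2 (- (\<i> * c3)) c0 (\<i> * c1) x = comb c0 c1 c2 c3 (m2 x)"
    "comb c3 (\<i> * c2) (- (\<i> * c1)) c0 x = comb c0 c1 c2 c3 (m3 x)" for x
    by (simp_all add: comb_def mult_table vec_eq_iff algebra_simps)
  then show "c0 = 0" "c1 = 0" "c2 = 0" "c3 = 0"
    using comb_eq_0_imp_scalar_part assms by metis+
qed

text \<open>The arguments of \<open>comb\<close> are the coordinates of \<open>A\<close> in the basis \<open>I, X, Y, Z\<close>.\<close>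

definition pauli_rep :: "complex^2^2 \<Rightarrow> complex^2 \<Rightarrow> complex^2" where
  "pauli_rep A = comb ((A$1$1 + A$2$2) / 2) ((A$1$2 + A$2$1) / 2)
     (\<i> * (A$1$2 - A$2$1) / 2) ((A$1$1 - A$2$2) / 2)"

lemma clinear_pauli_rep: "clinear (pauli_rep A)"
  unfolding clinear_iff pauli_rep_def comb_def
  by (simp add: add scale vec_eq_iff algebra_simps)

text \<open>This is the Pauli product rule: with vector parts p and q, the scalar part is
  \<open>p0*q0\<close> plus their dot product, and the vector part is \<open>p0\<close> q +
  \<open>q0\<close> p + \<i> (p cross q).\<close>

lemma comb_comp: "comb p0 p1 p2 p3 (comb q0 q1 q2 q3 x) =
  comb (p0*q0 + p1*q1 + p2*q2 + p3*q3) (p0*q1 + p1*q0 + \<i>*(p2*q3 - p3*q2))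
   (p0*q2 + p2*q0 + \<i>*(p3*q1 - p1*q3)) (p0*q3 + p3*q0 + \<i>*(p1*q2 - p2*q1)) x"
  by (simp only: comb_def add scale mult_table) (simp add: vec_eq_iff algebra_simps)

lemma pauli_rep_mult: "pauli_rep (A ** B) = pauli_rep A \<circ> pauli_rep B"
proof -
  have mm: "(A ** B) $ i $ j = A $ i $ 1 * B $ 1 $ j + A $ i $ 2 * B $ 2 $ j" for i j
    by (simp add: matrix_matrix_mult_def sum_2)
  \<comment> \<open>Reduces the claim to four polynomial identities in the matrix entries.\<close>
  have cong: "comb p0 p1 p2 p3 = comb q0 q1 q2 q3"
    if "p0 = q0" "p1 = q1" "p2 = q2" "p3 = q3" for p0 p1 p2 p3 q0 q1 q2 q3
    using that by simp
  have i_times: "\<i> * (\<i> * c) = - c" for c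
    by (simp flip: mult.assoc)
  show ?thesis
    unfolding fun_eq_iff o_apply pauli_rep_def comb_comp mm
    by (intro allI fun_cong[OF cong]; simp add: field_simps i_times)
qed

lemma pauli_rep_one: "pauli_rep (mat 1) = id"
  by (simp add: pauli_rep_def comb_def mat_def fun_eq_iff)

lemma pauli_rep_generators:
  "pauli_rep pauli_X = m1" "pauli_rep pauli_Y = m2" "pauli_rep pauli_Z = m3"
  by (simp_all add: pauli_rep_def comb_def pauli_X_def pauli_Y_def pauli_Z_def fun_eq_iff)

lemma inj_pauli_rep: "inj pauli_rep"
proof (rule injI)
  fix A B assume eq: "pauli_rep A = pauli_rep B"
  \<comment> \<open>By linearity in the matrix, injectivity amounts to a trivial kernel, and
    \<open>comb_eq_0_imp\<close> settles that.\<close>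
  have "pauli_rep (A - B) x = pauli_rep A x - pauli_rep B x" for x
    by (simp add: pauli_rep_def comb_def vec_eq_iff field_simps)
  then have "pauli_rep (A - B) x = 0" for x
    by (simp add: eq)
  from comb_eq_0_imp[OF this[unfolded pauli_rep_def]]
  have sums: "C$1$1 + C$2$2 = 0" "C$1$2 + C$2$1 = 0" "C$1$2 - C$2$1 = 0" "C$1$1 - C$2$2 = 0"
    if "C = A - B" for C
    using that by simp_all
  have entries: "p = 0" "q = 0" if "p + q = 0" "p - q = 0" for p q :: complex
    using that by (auto simp: add_eq_0_iff)
  have "A - B = 0"
    using entries[OF sums(1,4)[OF refl]] entries[OF sums(2,3)[OF refl]]
    by (simp add: vec_eq_iff forall_2)
  then show "A = B" by simp
qed

lemma pauli_rep_hom: "pauli_rep \<in> hom (units_of matrix_monoid) (units_of operator_monoid)"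
proof (rule hom_units_of)
  show "pauli_rep \<in> hom matrix_monoid operator_monoid"
    by (rule homI) (auto simp: matrix_monoid_def operator_monoid_def clinear_pauli_rep pauli_rep_mult)
  show "pauli_rep \<one>\<^bsub>matrix_monoid\<^esub> = \<one>\<^bsub>operator_monoid\<^esub>"
    by (simp add: matrix_monoid_def operator_monoid_def pauli_rep_one)
qed

lemma operator_group_iso: "operator_group {m1, m2, m3} \<cong> pauli_group"
proof -
  interpret M: group "units_of matrix_monoid"
    by (rule group_units_of_matrix_monoid)
  interpret group_hom "units_of matrix_monoid" "units_of operator_monoid" pauli_rep
    by (simp add: group_hom_def group_hom_axioms_def group_units_of_matrix_monoid
        group_units_of_operator_monoid pauli_rep_hom)
  \<comment> \<open>Being involutions, the generators are units, so
    \<open>subgroup_generated\<close> discards none of them.\<close>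
  have "pauli_X ** pauli_X = mat 1" "pauli_Y ** pauli_Y = mat 1" "pauli_Z ** pauli_Z = mat 1"
    by (simp_all add: pauli_X_def pauli_Y_def pauli_Z_def mat_def vec_eq_iff forall_2
        matrix_matrix_mult_def sum_2)
  then have "{pauli_X, pauli_Y, pauli_Z} \<subseteq> carrier (units_of matrix_monoid)"
    by (auto simp: units_of_def Units_def matrix_monoid_def)
  from iso_subgroup_generated_image[OF inj_on_subset[OF inj_pauli_rep subset_UNIV] this]
  have "pauli_group \<cong> operator_group {m1, m2, m3}"
    by (auto simp: is_iso_def pauli_group_def operator_group_def pauli_rep_generators)
  then show ?thesis
    unfolding pauli_group_def
    using group.iso_sym[OF M.group_subgroup_generated] by blast
qed

end

section \<open>The pseudo-fermionic operators\<close>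

lemma pauli_triple_pseudo_fermionic:
  assumes lin: "clinear a" "clinear b"
    and anti: "(\<lambda>x. (a \<circ> b) x + (b \<circ> a) x) = id"
    and nil: "a \<circ> a = (\<lambda>x. 0)" "b \<circ> b = (\<lambda>x. 0)"
  shows "pauli_triple (\<lambda>x. b x + a x) (\<lambda>x. \<i> *s (b x - a x)) (\<lambda>x. (a \<circ> b) x - (b \<circ> a) x)"
proof -
  have add: "a (x + y) = a x + a y" "b (x + y) = b x + b y"
    and scale: "a (c *s x) = c *s a x" "b (c *s x) = c *s b x" for x y c
    using lin by (auto simp: clinear_iff)
  have diff: "a (x - y) = a x - a y" "b (x - y) = b x - b y" for x y
    using lin by (simp_all add: vec.linear_diff)
  have zero: "a 0 = 0" "b 0 = 0"
    using scale[of 0 0] by simp_all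
  \<comment> \<open>Here \<open>2 * x\<close> is a componentwise product of vectors, hence not an
    instance of \<open>scale\<close>.\<close>
  have double: "a (2 * x) = 2 * a x" "b (2 * x) = 2 * b x" for x
    by (simp_all only: mult_2 add)
  have nil': "a (a x) = 0" "b (b x) = 0" for x
    using nil by (auto simp: fun_eq_iff)
  \<comment> \<open>Used as a rewrite rule this moves every \<open>a\<close> to the left of
    \<open>b\<close>; with nilpotency, all words reduce to combinations of \<open>x\<close>,
    \<open>a x\<close>, \<open>b x\<close> and \<open>a (b x)\<close>.\<close>
  have ba: "b (a x) = x - a (b x)" for x
    using anti by (auto simp: fun_eq_iff algebra_simps)
  show ?thesis
    by (rule pauli_triple.intro;
        simp add: clinear_iff fun_eq_iff add scale diff zero double nil' ba; simp add: vec_eq_iff algebra_simps)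
qed

section \<open>Hermitian adjoints\<close>

lemma clinear_cadjoint:
  assumes "clinear f"
  shows "clinear (cadjoint f)"
proof -
  define A where "A = matrix f"
  have f: "f x = A *v x" for x
    using matrix_works[OF assms] by (simp add: A_def)
  \<comment> \<open>By uniqueness the adjoint is the conjugate transpose, whose formula is visibly
    linear.\<close>
  have "cadjoint f = (\<lambda>y. \<chi> j. \<Sum>i\<in>UNIV. cnj (A $ i $ j) * y $ i)"
    by (rule cadjoint_unique)
      (simp add: f cinner_def matrix_vector_mult_def sum_2 algebra_simps)
  then show ?thesis
    by (simp add: clinear_iff vec_eq_iff sum_2 algebra_simps)
qed

lemma cadjoint_comp:
  assumes "clinear f" "clinear g"
  shows "cadjoint (f \<circ> g) = cadjoint g \<circ> cadjoint f"
  by (rule cadjoint_unique) (simp add: cadjoint_works assms)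

lemma cadjoint_id: "cadjoint id = id"
  by (rule cadjoint_unique) simp

lemma cadjoint_scale:
  assumes "clinear f"
  shows "cadjoint (\<lambda>x. c *s f x) = (\<lambda>x. cnj c *s cadjoint f x)"
proof (rule cadjoint_unique)
  fix x y
  have "cinner (c *s f x) y = cnj c * cinner (f x) y"
    by (simp add: cinner_def sum_2 algebra_simps)
  also have "\<dots> = cnj c * cinner x (cadjoint f y)"
    by (simp only: cadjoint_works[OF assms])
  also have "\<dots> = cinner x (cnj c *s cadjoint f y)"
    by (simp add: cinner_def sum_2 algebra_simps)
  finally show "cinner (c *s f x) y = cinner x (cnj c *s cadjoint f y)" .
qed

lemma (in pauli_triple) pauli_triple_cadjoint:
  "pauli_triple (cadjoint m1) (cadjoint m2) (cadjoint m3)"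
proof (rule pauli_triple.intro)
  \<comment> \<open>The reversed relations are the right start: taking adjoints restores the cyclic
    order and turns -\<i> into \<i>.\<close>
  have "m2 \<circ> m1 = (\<lambda>x. (-\<i>) *s m3 x)" "m3 \<circ> m2 = (\<lambda>x. (-\<i>) *s m1 x)" "m1 \<circ> m3 = (\<lambda>x. (-\<i>) *s m2 x)"
    by (simp_all only: fun_eq_iff o_apply reversed_apply simp_thms)
  then have "cadjoint (m2 \<circ> m1) = (\<lambda>x. cnj (-\<i>) *s cadjoint m3 x)"
    "cadjoint (m3 \<circ> m2) = (\<lambda>x. cnj (-\<i>) *s cadjoint m1 x)"
    "cadjoint (m1 \<circ> m3) = (\<lambda>x. cnj (-\<i>) *s cadjoint m2 x)"
    by (simp_all only: cadjoint_scale linear)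
  then show "cadjoint m1 \<circ> cadjoint m2 = (\<lambda>x. \<i> *s cadjoint m3 x)"
    "cadjoint m2 \<circ> cadjoint m3 = (\<lambda>x. \<i> *s cadjoint m1 x)"
    "cadjoint m3 \<circ> cadjoint m1 = (\<lambda>x. \<i> *s cadjoint m2 x)"
    by (simp_all add: cadjoint_comp linear)
  show "cadjoint m1 \<circ> cadjoint m1 = id" "cadjoint m2 \<circ> cadjoint m2 = id"
    "cadjoint m3 \<circ> cadjoint m3 = id"
    using linear by (simp_all add: square cadjoint_id flip: cadjoint_comp)
qed (rule clinear_cadjoint linear)+

theorem mainTheorem2:
  fixes a b \<mu>1 \<mu>2 \<mu>3 \<rho>1 \<rho>2 \<rho>3 :: "complex^2 \<Rightarrow> complex^2"
  assumes "clinear a" and "clinear b"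
    and "(\<lambda>x. (a \<circ> b) x + (b \<circ> a) x) = id"
    and "a \<circ> a = (\<lambda>x. 0)" and "b \<circ> b = (\<lambda>x. 0)"
    and "\<mu>1 = (\<lambda>x. b x + a x)"
    and "\<mu>2 = (\<lambda>x. \<i> *s (b x - a x))"
    and "\<mu>3 = (\<lambda>x. (a \<circ> b) x - (b \<circ> a) x)"
    and "\<rho>1 = cadjoint \<mu>1" and "\<rho>2 = cadjoint \<mu>2" and "\<rho>3 = cadjoint \<mu>3"
  shows
    "(\<mu>1 \<circ> \<mu>1 = id \<and> \<mu>2 \<circ> \<mu>2 = id \<and> \<mu>3 \<circ> \<mu>3 = id
      \<and> \<mu>1 \<circ> \<mu>2 = (\<lambda>x. \<i> *s \<mu>3 x)
      \<and> \<mu>2 \<circ> \<mu>3 = (\<lambda>x. \<i> *s \<mu>1 x)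
      \<and> \<mu>3 \<circ> \<mu>1 = (\<lambda>x. \<i> *s \<mu>2 x)
      \<and> (\<mu>1 \<circ> \<mu>2) ^^ 4 = id \<and> (\<mu>2 \<circ> \<mu>3) ^^ 4 = id \<and> (\<mu>3 \<circ> \<mu>1) ^^ 4 = id
      \<and> operator_group {\<mu>1, \<mu>2, \<mu>3} \<cong> pauli_group)
    \<and> (\<rho>1 \<circ> \<rho>1 = id \<and> \<rho>2 \<circ> \<rho>2 = id \<and> \<rho>3 \<circ> \<rho>3 = id
      \<and> \<rho>1 \<circ> \<rho>2 = (\<lambda>x. \<i> *s \<rho>3 x)
      \<and> \<rho>2 \<circ> \<rho>3 = (\<lambda>x. \<i> *s \<rho>1 x)
      \<and> \<rho>3 \<circ> \<rho>1 = (\<lambda>x. \<i> *s \<rho>2 x)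
      \<and> (\<rho>1 \<circ> \<rho>2) ^^ 4 = id \<and> (\<rho>2 \<circ> \<rho>3) ^^ 4 = id \<and> (\<rho>3 \<circ> \<rho>1) ^^ 4 = id
      \<and> operator_group {\<rho>1, \<rho>2, \<rho>3} \<cong> pauli_group)"
proof -
  interpret \<mu>: pauli_triple \<mu>1 \<mu>2 \<mu>3
    unfolding assms(6-8) using assms(1-5) by (rule pauli_triple_pseudo_fermionic)
  interpret \<rho>: pauli_triple \<rho>1 \<rho>2 \<rho>3
    unfolding assms(9-11) by (rule \<mu>.pauli_triple_cadjoint)
  show ?thesis
    by (intro conjI \<mu>.square \<mu>.cyclic \<mu>.funpow_4 \<mu>.operator_group_iso
        \<rho>.square \<rho>.cyclic \<rho>.funpow_4 \<rho>.operator_group_iso)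
qed

end
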